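(* Let $M$ be a non-degenerate Orlicz function satisfying the $\Delta_2$ condition at zero, and such that for some $p\in(1,2]$ $$\limsup_{t\searrow0}\frac{M(t)}{t^p}=\infty.$$ Then on $\ell_M$ there is no non-trivial Fréchet differentiable bump $b$ satisfying, for every $x\in\ell_M$, the estimate $$b(x+h)=b(x)+\langle b'(x),h\rangle+O(\|h\|^p)\quad\text{as }h\to0$$ (the constant in the $O$-term and the neighbourhood in which it holds may depend on $x$).
   Context: An Orlicz function is a continuous, non-decreasing, convex function $M:[0,\infty)\to[0,\infty)$ with $M(0)=0$ and $\lim_{t\to\infty}M(t)=\infty$. It is degenerate if $M(t)=0$ for some $t>0$, and non-degenerate otherwise. A non-degenerate $M$ satisfies the $\Delta_2$ condition at zero if $\liminf_{t\downarrow0}M(t)/M(2t)>0$. For a bounded real sequence $x$ put $\sigma_M(x)=\sum_{n=1}^\infty M(|x_n|)\in[0,\infty]$. The Orlicz sequence space $\ell_M$ is the linear space of all bounded real sequences $x$ with $\sigma_M(x/\rho)<\infty$ for some $\rho>0$, equipped with the norm $\|x\|=\inf\{\rho>0:\sigma_M(x/\rho)\le1\}$; it is a Banach space. A bump on a Banach space is a real-valued function on it with bounded support (the set where it is nonzero is bounded); it is non-trivial if it is not identically zero. Fréchet differentiable means Fréchet differentiable at every point, with derivative $b'(x)$ in the dual space. *)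

theory Defs
  imports "HOL-Analysis.Analysis" "HOL-Library.Landau_Symbols"
begin

text \<open>
  A function \<open>[0,\<infinity>) \<rightarrow> [0,\<infinity>)\<close> is represented by a function on all reals, of which only the
  values at non-negative arguments matter.
\<close>

definition orlicz_function :: "(real \<Rightarrow> real) \<Rightarrow> bool" where
  "orlicz_function M \<longleftrightarrow>
     M ` {0..} \<subseteq> {0..} \<and> continuous_on {0..} M \<and> mono_on {0..} M \<and> convex_on {0..} M \<and>
     M 0 = 0 \<and> filterlim M at_top at_top"

definition degenerate :: "(real \<Rightarrow> real) \<Rightarrow> bool" where
  "degenerate M \<longleftrightarrow> (\<exists>t>0. M t = 0)"

definition Delta2_at_zero :: "(real \<Rightarrow> real) \<Rightarrow> bool" where
  "Delta2_at_zero M \<longleftrightarrow> Liminf (at_right 0) (\<lambda>t. ereal (M t / M (2 * t))) > 0"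

definition orlicz_modular :: "(real \<Rightarrow> real) \<Rightarrow> (nat \<Rightarrow> real) \<Rightarrow> ennreal" where
  "orlicz_modular M x = (\<Sum>n. ennreal (M \<bar>x n\<bar>))"

text \<open>
  The space depends on \<open>M\<close>, so it is a set of sequences and not a type. Its vector space operations
  are pointwise, and functions on it are functions on all sequences whose values outside the set
  are irrelevant.
\<close>

definition orlicz_space :: "(real \<Rightarrow> real) \<Rightarrow> (nat \<Rightarrow> real) set" where
  "orlicz_space M =
     {x. bounded (range x) \<and> (\<exists>\<rho>>0. orlicz_modular M (\<lambda>n. x n / \<rho>) < \<infinity>)}"

definition orlicz_norm :: "(real \<Rightarrow> real) \<Rightarrow> (nat \<Rightarrow> real) \<Rightarrow> real" where
  "orlicz_norm M x = Inf {\<rho>. \<rho> > 0 \<and> orlicz_modular M (\<lambda>n. x n / \<rho>) \<le> 1}"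

definition orlicz_dual :: "(real \<Rightarrow> real) \<Rightarrow> ((nat \<Rightarrow> real) \<Rightarrow> real) set" where
  "orlicz_dual M =
     {L. (\<forall>x\<in>orlicz_space M. \<forall>y\<in>orlicz_space M. L (\<lambda>n. x n + y n) = L x + L y) \<and>
         (\<forall>x\<in>orlicz_space M. \<forall>c. L (\<lambda>n. c * x n) = c * L x) \<and>
         (\<exists>C. \<forall>x\<in>orlicz_space M. \<bar>L x\<bar> \<le> C * orlicz_norm M x)}"

text \<open>
  The filter of neighbourhoods of the origin in the space, for \<open>h \<rightarrow> 0\<close>. It does not exclude
  \<open>h = 0\<close>; this is harmless below, because the remainders and the bounds vanish there.
\<close>

definition orlicz_nhds_zero :: "(real \<Rightarrow> real) \<Rightarrow> (nat \<Rightarrow> real) filter" where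
  "orlicz_nhds_zero M =
     inf (filtercomap (orlicz_norm M) (nhds 0)) (principal (orlicz_space M))"

definition has_frechet_derivative ::
    "(real \<Rightarrow> real) \<Rightarrow> ((nat \<Rightarrow> real) \<Rightarrow> real) \<Rightarrow> ((nat \<Rightarrow> real) \<Rightarrow> real) \<Rightarrow> (nat \<Rightarrow> real) \<Rightarrow> bool"
  where
  "has_frechet_derivative M f L x \<longleftrightarrow>
     L \<in> orlicz_dual M \<and>
     (\<lambda>h. f (\<lambda>n. x n + h n) - f x - L h) \<in> o[orlicz_nhds_zero M](\<lambda>h. orlicz_norm M h)"

definition bump :: "(real \<Rightarrow> real) \<Rightarrow> ((nat \<Rightarrow> real) \<Rightarrow> real) \<Rightarrow> bool" where
  "bump M b \<longleftrightarrow> (\<exists>R. \<forall>x\<in>orlicz_space M. b x \<noteq> 0 \<longrightarrow> orlicz_norm M x \<le> R)"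

definition nontrivial :: "(real \<Rightarrow> real) \<Rightarrow> ((nat \<Rightarrow> real) \<Rightarrow> real) \<Rightarrow> bool" where
  "nontrivial M b \<longleftrightarrow> (\<exists>x\<in>orlicz_space M. b x \<noteq> 0)"

end

theory Submission imports Defs begin

text \<open>
  Let \<open>b\<close> be positive somewhere, and scale the modular \<open>S\<close> so that \<open>S \<le> 1\<close> on the support of \<open>b\<close>. Order
  the sequences by \<open>v \<preceq> w\<close> if each coordinate is kept or at least doubled in absolute value and
  \<open>b + \<epsilon>S\<close> does not decrease. Since \<open>S\<close> is bounded, the Brezis--Browder ordering principle gives a
  \<open>v\<close> above which \<open>S\<close> cannot increase. Now change a single small coordinate of \<open>v\<close> by \<open>\<plusminus>t\<close>, with the
  sign for which the derivative is non-negative: \<open>b\<close> drops by at most a multiple of \<open>t\<^sup>p\<close>, which for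
  suitable small \<open>t\<close> is less than \<open>\<epsilon>\<close> times the gain in \<open>S\<close>, of the order of \<open>M(t)\<close>, so the new
  sequence lies above \<open>v\<close> and has a larger modular.
\<close>

section \<open>The Brezis-Browder ordering principle\<close>

text \<open>Let \<open>U x\<close> be the supremum of \<open>f\<close> above \<open>x\<close>.
  Choosing each successor so as to halve the gap between \<open>U\<close> and \<open>f\<close> at
  the current point makes every upper bound of the resulting chain maximal for
  \<open>f\<close>.\<close>

lemma brezis_browder:
  fixes le :: "'a \<Rightarrow> 'a \<Rightarrow> bool" and f :: "'a \<Rightarrow> real"
  assumes "x0 \<in> A"
    and refl: "\<And>x. x \<in> A \<Longrightarrow> le x x"
    and trans: "\<And>x y z. x \<in> A \<Longrightarrow> y \<in> A \<Longrightarrow> z \<in> A \<Longrightarrow> le x y \<Longrightarrow> le y z \<Longrightarrow> le x z"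
    and mono: "\<And>x y. x \<in> A \<Longrightarrow> y \<in> A \<Longrightarrow> le x y \<Longrightarrow> f x \<le> f y"
    and bdd: "\<And>x. x \<in> A \<Longrightarrow> f x \<le> B"
    and chain: "\<And>x. (\<And>k::nat. x k \<in> A) \<Longrightarrow> (\<And>k. le (x k) (x (Suc k))) \<Longrightarrow> \<exists>v\<in>A. \<forall>k. le (x k) v"
  shows "\<exists>v\<in>A. \<forall>w\<in>A. le v w \<longrightarrow> f w \<le> f v"
proof -
  define U where "U x = (SUP y\<in>{y\<in>A. le x y}. f y)" for x
  have U_upper: "f y \<le> U x" if "y \<in> A" "le x y" for x y
    unfolding U_def using that bdd by (intro cSUP_upper bdd_aboveI2[of _ _ B]) auto
  have step: "\<exists>y. y \<in> A \<and> le x y \<and> U x - f y \<le> (U x - f x) / 2" if "x \<in> A" for x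
  proof (cases "f x < U x")
    case True
    have "\<exists>y\<in>{y\<in>A. le x y}. (U x + f x) / 2 < f y"
    proof (rule ccontr)
      assume "\<not> ?thesis"
      then have "U x \<le> (U x + f x) / 2"
        unfolding U_def[of x] using refl[OF that] that by (intro cSUP_least) (auto simp: not_less)
      then show False using True by simp
    qed
    then show ?thesis by (auto simp: field_simps intro: less_imp_le)
  next
    case False
    then show ?thesis using U_upper[OF that refl[OF that]] refl[OF that] that by auto
  qed
  have "\<exists>x. \<forall>k::nat. x k \<in> A \<and> (le (x k) (x (Suc k)) \<and>
      U (x k) - f (x (Suc k)) \<le> (U (x k) - f (x k)) / 2)"
    using step \<open>x0 \<in> A\<close>
    by (intro dependent_nat_choice[where Q = "\<lambda>_ x y. le x y \<and> U x - f y \<le> (U x - f x) / 2"]) auto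
  then obtain x where x: "\<And>k. x k \<in> A" "\<And>k. le (x k) (x (Suc k))"
    "\<And>k. U (x k) - f (x (Suc k)) \<le> (U (x k) - f (x k)) / 2"
    by blast
  obtain v where v: "v \<in> A" "\<And>k. le (x k) v"
    using chain[of x] x by auto
  have "f w \<le> f v" if "w \<in> A" "le v w" for w
  proof -
    have inc: "f (x k) \<le> f (x (Suc k))" for k
      using mono x by blast
    then have "incseq (\<lambda>k. f (x k))"
      by (rule incseq_SucI)
    then obtain L where L: "(\<lambda>k. f (x k)) \<longlonglongrightarrow> L"
      using bdd[OF x(1)] incseq_convergent by metis
    \<comment> \<open>Since \<open>w\<close> lies above \<open>x k\<close>, \<open>f w\<close> is at
      most \<open>U (x k)\<close>; the bound is the halving inequality solved for
      \<open>U (x k)\<close>. Its right side has the same limit as \<open>f (x k)\<close>.\<close>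
    have "f w \<le> 2 * f (x (Suc k)) - f (x k)" for k
      using U_upper[of w "x k"] that trans[OF x(1) v(1) that(1) v(2) that(2)] x(3)[of k] by simp
    moreover have "(\<lambda>k. 2 * f (x (Suc k)) - f (x k)) \<longlonglongrightarrow> 2 * L - L"
      using L LIMSEQ_Suc[OF L] by (intro tendsto_intros)
    ultimately have "f w \<le> L"
      by (intro LIMSEQ_le_const[of "\<lambda>k. 2 * f (x (Suc k)) - f (x k)"]) auto
    also have "L \<le> f v"
      using L mono[OF x(1) v(1) v(2)] by (intro LIMSEQ_le_const2) auto
    finally show ?thesis .
  qed
  then show ?thesis using v by blast
qed

section \<open>The doubling order on sequences\<close>

text \<open>
  The relation is chosen so that \<open>\<bar>w - v\<bar> \<le> 2\<bar>w\<bar>\<close> wherever \<open>w\<close> and \<open>v\<close> differ, while convexity makes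
  the increment of the modular control the modular of the increment.
\<close>

definition grows :: "(nat \<Rightarrow> real) \<Rightarrow> (nat \<Rightarrow> real) \<Rightarrow> bool" where
  "grows v w \<longleftrightarrow> (\<forall>n. w n = v n \<or> 2 * \<bar>v n\<bar> \<le> \<bar>w n\<bar>)"

lemma grows_refl: "grows v v"
  by (simp add: grows_def)

lemma grows_trans:
  assumes "grows u v" "grows v w"
  shows "grows u w"
  unfolding grows_def
proof
  fix n
  show "w n = u n \<or> 2 * \<bar>u n\<bar> \<le> \<bar>w n\<bar>"
    using assms[unfolded grows_def, rule_format, of n] by auto
qed

lemma grows_abs_le: "grows v w \<Longrightarrow> \<bar>v n\<bar> \<le> \<bar>w n\<bar>"
  by (auto simp: grows_def dest!: spec[of _ n])

text \<open>The absolute values increase to a limit \<open>L\<close>. Once they exceed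
  \<open>L / 2\<close>, a further change would at least double them beyond \<open>L\<close>.\<close>

lemma doubling_eventually_const:
  fixes u :: "nat \<Rightarrow> real"
  assumes step: "\<And>k. u (Suc k) = u k \<or> 2 * \<bar>u k\<bar> \<le> \<bar>u (Suc k)\<bar>" and bdd: "\<And>k. \<bar>u k\<bar> \<le> B"
  shows "\<exists>c. \<forall>\<^sub>F k in sequentially. u k = c"
proof -
  have inc: "incseq (\<lambda>k. \<bar>u k\<bar>)"
    by (rule incseq_SucI) (use step in \<open>smt (verit)\<close>)
  then obtain L where L: "(\<lambda>k. \<bar>u k\<bar>) \<longlonglongrightarrow> L" "\<And>k. \<bar>u k\<bar> \<le> L"
    using incseq_convergent[OF inc] bdd by metis
  show ?thesis
  proof (cases "L = 0")
    case True
    then show ?thesis using L(2) by (intro exI[of _ 0]) auto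
  next
    case False
    then have "L > 0"
      using L(2)[of 0] by linarith
    then have "\<forall>\<^sub>F k in sequentially. L / 2 < \<bar>u k\<bar>"
      using L(1) by (intro order_tendstoD) auto
    then obtain K where K: "\<And>k. k \<ge> K \<Longrightarrow> L / 2 < \<bar>u k\<bar>"
      by (auto simp: eventually_sequentially)
    have "u k = u K" if "k \<ge> K" for k
      using that
    proof (induction k rule: dec_induct)
      case (step k)
      then show ?case using assms(1)[of k] K[of k] L(2)[of "Suc k"] by auto
    qed simp
    then show ?thesis by (auto simp: eventually_sequentially)
  qed
qed

section \<open>Elementary properties of Orlicz functions\<close>

locale orlicz =
  fixes M :: "real \<Rightarrow> real"
  assumes orlicz: "orlicz_function M" and nondegenerate: "\<not> degenerate M"
begin

lemma M_zero [simp]: "M 0 = 0"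
  using orlicz by (simp add: orlicz_function_def)

lemma M_nonneg: "0 \<le> t \<Longrightarrow> 0 \<le> M t"
  using orlicz by (auto simp: orlicz_function_def)

lemma M_mono: "0 \<le> s \<Longrightarrow> s \<le> t \<Longrightarrow> M s \<le> M t"
  using orlicz by (auto simp: orlicz_function_def mono_on_def)

lemma M_pos: "0 < t \<Longrightarrow> 0 < M t"
  using nondegenerate M_nonneg[of t] by (force simp: degenerate_def)

lemma M_mult_le: "0 \<le> t \<Longrightarrow> 0 \<le> c \<Longrightarrow> c \<le> 1 \<Longrightarrow> M (c * t) \<le> c * M t"
  using orlicz convex_onD[of "{0..}" M c 0 t] by (auto simp: orlicz_function_def)

lemma M_half: "0 \<le> t \<Longrightarrow> M (t / 2) \<le> M t / 2"
  using M_mult_le[of t "1/2"] by simp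

lemma M_unbounded: "\<exists>T>0. \<forall>t\<ge>T. c < M t"
proof -
  have "\<forall>\<^sub>F t in at_top. c < M t"
    using orlicz by (auto simp: orlicz_function_def filterlim_at_top_dense)
  then obtain T where "\<And>t. t \<ge> T \<Longrightarrow> c < M t"
    by (auto simp: eventually_at_top_linorder)
  then show ?thesis by (intro exI[of _ "max T 1"]) auto
qed

section \<open>The modular at a given scale and the norm\<close>

text \<open>A real-valued modular, so that differences and limits can be taken freely. Its value
  carries information only together with \<open>modsummable\<close>, as the sum of a divergent
  series is unspecified.\<close>

definition modsum :: "real \<Rightarrow> (nat \<Rightarrow> real) \<Rightarrow> real" where
  "modsum \<rho> x = (\<Sum>n. M (\<bar>x n\<bar> / \<rho>))"

definition modsummable :: "real \<Rightarrow> (nat \<Rightarrow> real) \<Rightarrow> bool" where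
  "modsummable \<rho> x \<longleftrightarrow> summable (\<lambda>n. M (\<bar>x n\<bar> / \<rho>))"

lemma modsum_nonneg: "0 < \<rho> \<Longrightarrow> modsummable \<rho> x \<Longrightarrow> 0 \<le> modsum \<rho> x"
  by (auto simp: modsum_def modsummable_def intro!: suminf_nonneg M_nonneg)

lemma term_le_modsum:
  assumes "0 < \<rho>" "modsummable \<rho> x"
  shows "M (\<bar>x n\<bar> / \<rho>) \<le> modsum \<rho> x"
  using sum_le_suminf[of "\<lambda>n. M (\<bar>x n\<bar> / \<rho>)" "{n}"] assms
  by (auto simp: modsum_def modsummable_def M_nonneg)

lemma orlicz_modular_eq:
  assumes "0 < \<rho>" "modsummable \<rho> x"
  shows "orlicz_modular M (\<lambda>n. x n / \<rho>) = ennreal (modsum \<rho> x)"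
  using assms unfolding orlicz_modular_def modsum_def modsummable_def
  by (auto simp: suminf_ennreal2 M_nonneg)

lemma modsummable_iff:
  assumes "0 < \<rho>"
  shows "modsummable \<rho> x \<longleftrightarrow> orlicz_modular M (\<lambda>n. x n / \<rho>) < \<infinity>"
proof
  assume "orlicz_modular M (\<lambda>n. x n / \<rho>) < \<infinity>"
  then show "modsummable \<rho> x"
    unfolding orlicz_modular_def modsummable_def using assms
    by (intro summable_suminf_not_top) (auto simp: M_nonneg)
qed (simp add: orlicz_modular_eq assms)

lemma orlicz_modular_le_1_iff:
  assumes "0 < \<rho>"
  shows "orlicz_modular M (\<lambda>n. x n / \<rho>) \<le> 1 \<longleftrightarrow> modsummable \<rho> x \<and> modsum \<rho> x \<le> 1"
proof (cases "modsummable \<rho> x")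
  case True
  then show ?thesis using assms by (simp add: orlicz_modular_eq)
next
  case False
  then have "orlicz_modular M (\<lambda>n. x n / \<rho>) = \<infinity>"
    using modsummable_iff[OF assms] by (simp add: less_top[symmetric])
  then show ?thesis using False by (simp add: top_unique)
qed

lemma modsum_mono:
  assumes "0 < \<rho>" "0 < \<rho>'" "modsummable \<rho> x" "\<And>n. \<bar>y n\<bar> / \<rho>' \<le> \<bar>x n\<bar> / \<rho>"
  shows "modsummable \<rho>' y" "modsum \<rho>' y \<le> modsum \<rho> x"
proof -
  show *: "modsummable \<rho>' y"
    unfolding modsummable_def
    by (rule summable_comparison_test[OF _ assms(3)[unfolded modsummable_def]])
      (use assms in \<open>auto simp: M_nonneg intro!: M_mono\<close>)
  show "modsum \<rho>' y \<le> modsum \<rho> x"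
    unfolding modsum_def using * assms
    by (intro suminf_le M_mono) (auto simp: modsummable_def)
qed

text \<open>Boundedness comes from \<open>M\<close> tending to infinity: no single term can exceed
  the whole modular.\<close>

lemma modsummable_imp_mem:
  assumes "0 < \<rho>" "modsummable \<rho> x"
  shows "x \<in> orlicz_space M"
proof -
  obtain T where T: "\<And>t. t \<ge> T \<Longrightarrow> modsum \<rho> x < M t"
    using M_unbounded by blast
  have "\<bar>x n\<bar> \<le> T * \<rho>" for n
    using T[of "\<bar>x n\<bar> / \<rho>"] term_le_modsum[OF assms, of n] assms(1)
    by (smt (verit) pos_le_divide_eq)
  then have "bounded (range x)"
    by (auto simp: bounded_iff)
  then show ?thesis
    using assms modsummable_iff by (auto simp: orlicz_space_def)
qed

text \<open>This makes the infimum in \<open>orlicz_norm\<close> meaningful. By convexity, enlarging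
  the scale from \<open>\<rho>\<close> to \<open>\<rho> / c\<close> multiplies the modular by at
  most \<open>c\<close>.\<close>

lemma norm_set_nonempty:
  assumes "x \<in> orlicz_space M"
  shows "{\<rho>. \<rho> > 0 \<and> orlicz_modular M (\<lambda>n. x n / \<rho>) \<le> 1} \<noteq> {}"
proof -
  obtain \<rho> where \<rho>: "\<rho> > 0" "modsummable \<rho> x"
    using assms modsummable_iff by (auto simp: orlicz_space_def)
  define c where "c = 1 / (1 + modsum \<rho> x)"
  have c: "0 < c" "c \<le> 1" "c * modsum \<rho> x \<le> 1"
    using modsum_nonneg[OF \<rho>] by (auto simp: c_def field_simps)
  have le: "M (\<bar>x n\<bar> / (\<rho> / c)) \<le> c * M (\<bar>x n\<bar> / \<rho>)" for n
    using M_mult_le[of "\<bar>x n\<bar> / \<rho>" c] c \<rho> by (simp add: field_simps)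
  have sm: "summable (\<lambda>n. c * M (\<bar>x n\<bar> / \<rho>))"
    using \<rho> by (auto simp: modsummable_def)
  have *: "modsummable (\<rho> / c) x"
    unfolding modsummable_def
    by (rule summable_comparison_test[OF _ sm]) (use le c \<rho> in \<open>auto simp: M_nonneg\<close>)
  have "modsum (\<rho> / c) x \<le> c * modsum \<rho> x"
    unfolding modsum_def using \<rho> le sm *
    by (subst suminf_mult[symmetric]) (auto simp: modsummable_def intro!: suminf_le)
  then have "orlicz_modular M (\<lambda>n. x n / (\<rho> / c)) \<le> 1"
    using orlicz_modular_le_1_iff[of "\<rho> / c" x] * c \<rho> by auto
  moreover have "0 < \<rho> / c"
    using c \<rho> by simp
  ultimately have "\<rho> / c \<in> {\<rho>. \<rho> > 0 \<and> orlicz_modular M (\<lambda>n. x n / \<rho>) \<le> 1}"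
    by (intro CollectI conjI)
  then show ?thesis by (metis empty_iff)
qed

lemma orlicz_norm_nonneg: "x \<in> orlicz_space M \<Longrightarrow> 0 \<le> orlicz_norm M x"
  unfolding orlicz_norm_def using norm_set_nonempty by (intro cInf_greatest) auto

lemma orlicz_norm_le:
  assumes "0 < \<rho>" "modsummable \<rho> x" "modsum \<rho> x \<le> 1"
  shows "orlicz_norm M x \<le> \<rho>"
  unfolding orlicz_norm_def using assms
  by (intro cInf_lower bdd_belowI[of _ 0]) (auto simp: orlicz_modular_le_1_iff)

lemma modsum_le_1:
  assumes "x \<in> orlicz_space M" "orlicz_norm M x < \<rho>"
  shows "modsummable \<rho> x" "modsum \<rho> x \<le> 1"
proof -
  obtain r where r: "0 < r" "r < \<rho>" "modsummable r x" "modsum r x \<le> 1"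
    using cInf_lessD[OF norm_set_nonempty[OF assms(1)] assms(2)[unfolded orlicz_norm_def]]
    by (auto simp: orlicz_modular_le_1_iff)
  have "\<bar>x n\<bar> / \<rho> \<le> \<bar>x n\<bar> / r" for n
    using r by (intro divide_left_mono) auto
  with r show "modsummable \<rho> x" "modsum \<rho> x \<le> 1"
    using modsum_mono[of r \<rho> x x] by auto
qed

text \<open>Where \<open>w\<close> differs from \<open>v\<close>, convexity shows that at least half
  of the term of \<open>w\<close> is increment. The scale \<open>2 * \<rho>\<close> absorbs the
  factor in \<open>\<bar>v n - w n\<bar> \<le> 2 * \<bar>w n\<bar>\<close>.\<close>

lemma grows_modsum:
  assumes "0 < \<rho>" "grows v w" "modsummable \<rho> w"
  shows "modsummable \<rho> v" "modsum \<rho> v \<le> modsum \<rho> w"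
    "modsummable (2 * \<rho>) (\<lambda>n. v n - w n)"
    "modsum (2 * \<rho>) (\<lambda>n. v n - w n) \<le> 2 * (modsum \<rho> w - modsum \<rho> v)"
proof -
  have v: "modsummable \<rho> v" "modsum \<rho> v \<le> modsum \<rho> w"
    using modsum_mono[of \<rho> \<rho> w v] assms grows_abs_le[of v w] by (auto simp: divide_right_mono)
  have le: "M (\<bar>v n - w n\<bar> / (2 * \<rho>)) \<le> 2 * (M (\<bar>w n\<bar> / \<rho>) - M (\<bar>v n\<bar> / \<rho>))" for n
  proof (cases "w n = v n")
    case False
    then have 2: "2 * \<bar>v n\<bar> \<le> \<bar>w n\<bar>"
      using assms(2) by (auto simp: grows_def)
    then have "M (\<bar>v n\<bar> / \<rho>) \<le> M (\<bar>w n\<bar> / \<rho> / 2)"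
      using assms(1) by (intro M_mono) (auto simp: field_simps)
    also have "\<dots> \<le> M (\<bar>w n\<bar> / \<rho>) / 2"
      using assms(1) by (intro M_half) auto
    finally have "M (\<bar>w n\<bar> / \<rho>) \<le> 2 * (M (\<bar>w n\<bar> / \<rho>) - M (\<bar>v n\<bar> / \<rho>))"
      by simp
    moreover have "\<bar>v n - w n\<bar> \<le> 2 * \<bar>w n\<bar>"
      using 2 by linarith
    then have "M (\<bar>v n - w n\<bar> / (2 * \<rho>)) \<le> M (\<bar>w n\<bar> / \<rho>)"
      using assms(1) by (intro M_mono) (auto simp: field_simps)
    ultimately show ?thesis by linarith
  qed simp
  have sm: "summable (\<lambda>n. 2 * (M (\<bar>w n\<bar> / \<rho>) - M (\<bar>v n\<bar> / \<rho>)))"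
    using v assms unfolding modsummable_def by (intro summable_mult summable_diff)
  have *: "modsummable (2 * \<rho>) (\<lambda>n. v n - w n)"
    unfolding modsummable_def
    by (rule summable_comparison_test[OF _ sm]) (use le assms in \<open>auto simp: M_nonneg\<close>)
  have "modsum (2 * \<rho>) (\<lambda>n. v n - w n) \<le> (\<Sum>n. 2 * (M (\<bar>w n\<bar> / \<rho>) - M (\<bar>v n\<bar> / \<rho>)))"
    unfolding modsum_def using le sm * by (intro suminf_le) (auto simp: modsummable_def)
  also have "\<dots> = 2 * (modsum \<rho> w - modsum \<rho> v)"
    using v assms unfolding modsummable_def modsum_def
    by (subst suminf_mult) (auto simp: suminf_diff intro: summable_diff)
  finally show "modsum (2 * \<rho>) (\<lambda>n. v n - w n) \<le> 2 * (modsum \<rho> w - modsum \<rho> v)" .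
  show "modsummable \<rho> v" "modsum \<rho> v \<le> modsum \<rho> w" "modsummable (2 * \<rho>) (\<lambda>n. v n - w n)"
    by fact+
qed

section \<open>Consequences of the Delta2 condition\<close>

lemma Delta2_bound:
  assumes "Delta2_at_zero M"
  shows "\<exists>\<delta>>0. \<exists>K>0. \<forall>t. 0 \<le> t \<and> t \<le> \<delta> \<longrightarrow> M (2 * t) \<le> K * M t"
proof -
  obtain c where c: "0 < ereal c" "ereal c < Liminf (at_right 0) (\<lambda>t. ereal (M t / M (2 * t)))"
    using ereal_dense2[OF assms[unfolded Delta2_at_zero_def]] by auto
  then have "\<forall>\<^sub>F t in at_right 0. ereal c < ereal (M t / M (2 * t))"
    by (auto dest: less_LiminfD)
  then obtain d where d: "d > 0" "\<And>t. 0 < t \<Longrightarrow> t < d \<Longrightarrow> c < M t / M (2 * t)"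
    by (auto simp: eventually_at_right_field)
  have "M (2 * t) \<le> (1 / c) * M t" if "0 \<le> t" "t \<le> d / 2" for t
  proof (cases "t = 0")
    case False
    then have "c < M t / M (2 * t)" "0 < M (2 * t)"
      using d that M_pos[of "2 * t"] by auto
    then show ?thesis using c by (simp add: field_simps)
  qed simp
  then show ?thesis using c d by (intro exI[of _ "d / 2"] conjI exI[of _ "1 / c"]) auto
qed

lemma Delta2_pow_bound:
  assumes "Delta2_at_zero M"
  shows "\<exists>\<delta>>0. \<exists>K>0. \<forall>t. 0 \<le> t \<and> t \<le> \<delta> \<longrightarrow> M (2 ^ j * t) \<le> K * M t"
proof (induction j)
  case 0
  then show ?case by (intro exI[of _ 1] conjI) auto
next
  case (Suc j)
  then obtain d K where IH: "d > 0" "K > 0"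
    "\<And>t. 0 \<le> t \<Longrightarrow> t \<le> d \<Longrightarrow> M (2 ^ j * t) \<le> K * M t" by blast
  obtain d' K' where B: "d' > 0" "K' > 0"
    "\<And>t. 0 \<le> t \<Longrightarrow> t \<le> d' \<Longrightarrow> M (2 * t) \<le> K' * M t"
    using Delta2_bound[OF assms] by blast
  \<comment> \<open>The second bound on \<open>t\<close> keeps \<open>2 ^ j * t\<close> within the
    range \<open>d'\<close> of the one-step estimate.\<close>
  have "M (2 ^ Suc j * t) \<le> (K' * K) * M t" if "0 \<le> t" "t \<le> min d (d' / 2 ^ j)" for t
  proof -
    have "M (2 * (2 ^ j * t)) \<le> K' * M (2 ^ j * t)"
      using that by (intro B) (auto simp: field_simps)
    also have "\<dots> \<le> K' * (K * M t)"
      using that B IH by (intro mult_left_mono) auto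
    finally show ?thesis by (simp add: mult.assoc)
  qed
  then show ?case using IH B by (intro exI[of _ "min d (d' / 2 ^ j)"] conjI exI[of _ "K' * K"]) auto
qed

text \<open>Under Delta2, a small modular at one fixed scale forces a small norm: passing from scale
  \<open>\<rho>\<close> to \<open>e\<close> takes finitely many doublings, each costing a constant
  factor.\<close>

lemma norm_small_if_modsum_small:
  assumes "Delta2_at_zero M" "0 < \<rho>" "0 < e"
  shows "\<exists>\<theta>>0. \<forall>x. modsummable \<rho> x \<and> modsum \<rho> x < \<theta> \<longrightarrow> orlicz_norm M x \<le> e"
proof -
  obtain j where j: "\<rho> / e < 2 ^ j"
    using real_arch_pow[of 2 "\<rho> / e"] by auto
  obtain d K where dK: "d > 0" "K > 0"
    "\<And>t. 0 \<le> t \<Longrightarrow> t \<le> d \<Longrightarrow> M (2 ^ j * t) \<le> K * M t"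
    using Delta2_pow_bound[OF assms(1), of j] by blast
  \<comment> \<open>The threshold \<open>M d\<close> puts every coordinate in the range where the
    doubling estimate holds; \<open>1 / K\<close> then brings the modular at scale \<open>e\<close>
    down to at most 1.\<close>
  have "orlicz_norm M x \<le> e" if x: "modsummable \<rho> x" "modsum \<rho> x < min (M d) (1 / K)" for x
  proof -
    have le: "M (\<bar>x n\<bar> / e) \<le> K * M (\<bar>x n\<bar> / \<rho>)" for n
    proof -
      have "M (\<bar>x n\<bar> / \<rho>) < M d"
        using term_le_modsum[OF assms(2) x(1), of n] x(2) by simp
      then have "\<bar>x n\<bar> / \<rho> \<le> d"
        using M_mono[of d "\<bar>x n\<bar> / \<rho>"] dK by linarith
      then have "M (2 ^ j * (\<bar>x n\<bar> / \<rho>)) \<le> K * M (\<bar>x n\<bar> / \<rho>)"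
        using assms by (intro dK) auto
      moreover have "\<bar>x n\<bar> / e = (\<rho> / e) * (\<bar>x n\<bar> / \<rho>)"
        using assms by simp
      then have "\<bar>x n\<bar> / e \<le> 2 ^ j * (\<bar>x n\<bar> / \<rho>)"
        using j assms by (metis abs_ge_zero divide_nonneg_pos less_imp_le mult_right_mono)
      then have "M (\<bar>x n\<bar> / e) \<le> M (2 ^ j * (\<bar>x n\<bar> / \<rho>))"
        using assms by (intro M_mono) auto
      ultimately show ?thesis by linarith
    qed
    have sm: "summable (\<lambda>n. K * M (\<bar>x n\<bar> / \<rho>))"
      using x by (auto simp: modsummable_def)
    have *: "modsummable e x"
      unfolding modsummable_def
      by (rule summable_comparison_test[OF _ sm]) (use le assms in \<open>auto simp: M_nonneg\<close>)
    have "modsum e x \<le> K * modsum \<rho> x"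
      unfolding modsum_def using x le sm *
      by (subst suminf_mult[symmetric]) (auto simp: modsummable_def intro!: suminf_le)
    also have "\<dots> \<le> 1"
      using x dK by (simp add: field_simps)
    finally show ?thesis using * assms by (intro orlicz_norm_le)
  qed
  moreover have "0 < min (M d) (1 / K)"
    using dK M_pos by auto
  ultimately show ?thesis by blast
qed

section \<open>Limits of growing chains\<close>

text \<open>Each coordinate is eventually constant, which defines \<open>v\<close>. The modulars
  increase to some \<open>s\<close> that bounds the modular of \<open>v\<close>, so the modular of
  \<open>x k - v\<close> is at most twice \<open>s - modsum \<rho> (x k)\<close> and tends to 0;
  Delta2 turns this into norm convergence.\<close>

lemma grows_chain_limit:
  assumes "Delta2_at_zero M" "0 < \<rho>" and gr: "\<And>k. grows (x k) (x (Suc k))"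
    and sm: "\<And>k. modsummable \<rho> (x k)" and B: "\<And>k. modsum \<rho> (x k) \<le> B"
  shows "\<exists>v. modsummable \<rho> v \<and> modsum \<rho> v \<le> B \<and> (\<forall>k. grows (x k) v) \<and>
    (\<lambda>k. orlicz_norm M (\<lambda>n. x k n - v n)) \<longlonglongrightarrow> 0"
proof -
  have gr': "grows (x k) (x m)" if "k \<le> m" for k m
    using that by (induction m rule: dec_induct) (auto intro: grows_refl grows_trans gr)
  obtain T where T: "\<And>t. t \<ge> T \<Longrightarrow> B < M t"
    using M_unbounded by blast
  have "\<bar>x k n\<bar> \<le> T * \<rho>" for k n
    using T[of "\<bar>x k n\<bar> / \<rho>"] term_le_modsum[OF assms(2) sm, of k n] B[of k] assms(2)
    by (smt (verit) pos_le_divide_eq)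
  then have "\<exists>c. \<forall>\<^sub>F k in sequentially. x k n = c" for n
    using gr by (intro doubling_eventually_const[of _ "T * \<rho>"]) (auto simp: grows_def)
  then obtain v where v: "\<And>n. \<forall>\<^sub>F k in sequentially. x k n = v n"
    by metis
  have "incseq (\<lambda>k. modsum \<rho> (x k))"
    using grows_modsum(2)[OF assms(2) gr sm] by (rule incseq_SucI)
  then obtain s where s: "(\<lambda>k. modsum \<rho> (x k)) \<longlonglongrightarrow> s" "\<And>k. modsum \<rho> (x k) \<le> s"
    using B incseq_convergent by metis
  \<comment> \<open>Finitely many coordinates agree with those of one common
    \<open>x k\<close>.\<close>
  have partial: "(\<Sum>n<N. M (\<bar>v n\<bar> / \<rho>)) \<le> s" for N
  proof -
    have "\<forall>\<^sub>F k in sequentially. \<forall>n\<in>{..<N}. x k n = v n"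
      using v by (intro eventually_ball_finite) auto
    then obtain k where "\<forall>n\<in>{..<N}. x k n = v n"
      using eventually_happens by fastforce
    then have "(\<Sum>n<N. M (\<bar>v n\<bar> / \<rho>)) = (\<Sum>n<N. M (\<bar>x k n\<bar> / \<rho>))"
      by (intro sum.cong) auto
    also have "\<dots> \<le> modsum \<rho> (x k)"
      unfolding modsum_def using sm assms
      by (intro sum_le_suminf) (auto simp: modsummable_def M_nonneg)
    finally show ?thesis using s(2)[of k] by simp
  qed
  have smv: "modsummable \<rho> v"
    unfolding modsummable_def
  proof (rule bounded_imp_summable)
    show "(\<Sum>n\<le>N. M (\<bar>v n\<bar> / \<rho>)) \<le> s" for N
      using partial[of "Suc N"] by (simp only: lessThan_Suc_atMost)
  qed (use assms in \<open>simp add: M_nonneg\<close>)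
  have vs: "modsum \<rho> v \<le> s"
    unfolding modsum_def using smv partial by (intro suminf_le_const) (auto simp: modsummable_def)
  have "s \<le> B"
    using s B by (intro LIMSEQ_le_const2[OF s(1)]) auto
  have grv: "grows (x k) v" for k
    unfolding grows_def
  proof
    fix n
    have "\<forall>\<^sub>F m in sequentially. x m n = v n \<and> m \<ge> k"
      using v eventually_ge_at_top by (intro eventually_conj)
    then obtain m where "x m n = v n" "m \<ge> k"
      using eventually_happens by fastforce
    then show "v n = x k n \<or> 2 * \<bar>x k n\<bar> \<le> \<bar>v n\<bar>"
      using gr'[of k m] by (auto simp: grows_def dest!: spec[of _ n])
  qed
  have "(\<lambda>k. orlicz_norm M (\<lambda>n. x k n - v n)) \<longlonglongrightarrow> 0"
  proof (rule LIMSEQ_I)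
    fix r :: real assume "r > 0"
    obtain \<theta> where \<theta>: "\<theta> > 0"
      "\<And>y. modsummable (2 * \<rho>) y \<Longrightarrow> modsum (2 * \<rho>) y < \<theta> \<Longrightarrow> orlicz_norm M y \<le> r / 2"
      using norm_small_if_modsum_small[OF assms(1), of "2 * \<rho>" "r / 2"] assms(2) \<open>r > 0\<close> by auto
    \<comment> \<open>Half of \<open>\<theta>\<close> compensates the factor 2 in
      \<open>grows_modsum\<close>.\<close>
    have "\<forall>\<^sub>F k in sequentially. s - \<theta> / 2 < modsum \<rho> (x k)"
      using s(1) \<theta>(1) by (intro order_tendstoD) auto
    then obtain K where K: "\<And>k. k \<ge> K \<Longrightarrow> s - \<theta> / 2 < modsum \<rho> (x k)"
      by (auto simp: eventually_sequentially)
    have "norm (orlicz_norm M (\<lambda>n. x k n - v n) - 0) < r" if "k \<ge> K" for k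
    proof -
      note d = grows_modsum(3,4)[OF assms(2) grv smv, of k]
      have "orlicz_norm M (\<lambda>n. x k n - v n) \<le> r / 2"
        using d vs K[OF that] by (intro \<theta>) auto
      moreover have "0 \<le> orlicz_norm M (\<lambda>n. x k n - v n)"
        using d assms(2) by (intro orlicz_norm_nonneg modsummable_imp_mem[of "2 * \<rho>"]) auto
      ultimately show ?thesis using \<open>r > 0\<close> by simp
    qed
    then show "\<exists>no. \<forall>n\<ge>no. norm (orlicz_norm M (\<lambda>na. x n na - v na) - 0) < r" by blast
  qed
  then show ?thesis using smv vs \<open>s \<le> B\<close> grv by (intro exI[of _ v]) auto
qed

section \<open>Changing a single coordinate\<close>

lemma modsum_single:
  assumes "0 < \<rho>"
  shows "modsummable \<rho> (\<lambda>k. if k = n then t else 0)"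
    "modsum \<rho> (\<lambda>k. if k = n then t else 0) = M (\<bar>t\<bar> / \<rho>)"
proof -
  have "(\<lambda>k. M (\<bar>if k = n then t else 0\<bar> / \<rho>)) = (\<lambda>k. if k = n then M (\<bar>t\<bar> / \<rho>) else 0)"
    by auto
  then have "(\<lambda>k. M (\<bar>if k = n then t else 0\<bar> / \<rho>)) sums M (\<bar>t\<bar> / \<rho>)"
    using sums_single[of n "\<lambda>_. M (\<bar>t\<bar> / \<rho>)"] by simp
  then show "modsummable \<rho> (\<lambda>k. if k = n then t else 0)"
    "modsum \<rho> (\<lambda>k. if k = n then t else 0) = M (\<bar>t\<bar> / \<rho>)"
    by (auto simp: modsummable_def modsum_def sums_iff)
qed

lemma norm_single_le: "\<exists>\<kappa>>0. \<forall>n t. orlicz_norm M (\<lambda>k. if k = n then t else 0) \<le> \<kappa> * \<bar>t\<bar>"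
proof -
  \<comment> \<open>Convexity gives \<open>M \<tau> \<le> 1\<close>, so the scale
    \<open>\<bar>t\<bar> / \<tau>\<close> is admissible for the norm, independently of
    \<open>n\<close>.\<close>
  define \<tau> where "\<tau> = 1 / (1 + M 1)"
  have \<tau>: "0 < \<tau>" "\<tau> \<le> 1" "\<tau> * M 1 \<le> 1"
    using M_nonneg[of 1] by (auto simp: \<tau>_def field_simps)
  then have \<tau>1: "M \<tau> \<le> 1"
    using M_mult_le[of 1 \<tau>] by simp
  have "orlicz_norm M (\<lambda>k. if k = n then t else 0) \<le> (1 / \<tau>) * \<bar>t\<bar>" for n t
  proof (cases "t = 0")
    \<comment> \<open>That scale would be zero here; instead every positive scale is
      admissible.\<close>
    case True
    have "orlicz_norm M (\<lambda>k. if k = n then t else 0) \<le> \<rho>" if "\<rho> > 0" for \<rho>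
      using modsum_single[OF that, of n t] that True by (intro orlicz_norm_le) auto
    then show ?thesis using True dense_ge[of 0] by auto
  next
    case False
    then show ?thesis
      using modsum_single[of "(1 / \<tau>) * \<bar>t\<bar>" n t] \<tau> \<tau>1 by (intro orlicz_norm_le) auto
  qed
  then show ?thesis using \<tau> by (intro exI[of _ "1 / \<tau>"]) auto
qed

lemma modsum_add_single:
  assumes "0 < \<rho>" "modsummable \<rho> v"
  shows "modsummable \<rho> (\<lambda>k. v k + (if k = n then t else 0))"
    "modsum \<rho> (\<lambda>k. v k + (if k = n then t else 0)) =
       modsum \<rho> v + (M (\<bar>v n + t\<bar> / \<rho>) - M (\<bar>v n\<bar> / \<rho>))"
proof -
  define d where "d = M (\<bar>v n + t\<bar> / \<rho>) - M (\<bar>v n\<bar> / \<rho>)"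
  have "(\<lambda>k. M (\<bar>v k\<bar> / \<rho>) + (if k = n then d else 0)) sums (modsum \<rho> v + d)"
    using assms sums_single[of n "\<lambda>_. d"]
    by (intro sums_add) (auto simp: modsum_def modsummable_def sums_iff)
  moreover have "(\<lambda>k. M (\<bar>v k\<bar> / \<rho>) + (if k = n then d else 0)) =
      (\<lambda>k. M (\<bar>v k + (if k = n then t else 0)\<bar> / \<rho>))"
    by (auto simp: d_def)
  ultimately have "(\<lambda>k. M (\<bar>v k + (if k = n then t else 0)\<bar> / \<rho>)) sums (modsum \<rho> v + d)"
    by simp
  then show "modsummable \<rho> (\<lambda>k. v k + (if k = n then t else 0))"
    "modsum \<rho> (\<lambda>k. v k + (if k = n then t else 0)) =
       modsum \<rho> v + (M (\<bar>v n + t\<bar> / \<rho>) - M (\<bar>v n\<bar> / \<rho>))"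
    by (auto simp: modsummable_def modsum_def sums_iff d_def)
qed

text \<open>The terms of the modular tend to 0, while \<open>M (c / \<rho>)\<close> is positive by
  non-degeneracy.\<close>

lemma exists_small_coordinate:
  assumes "0 < \<rho>" "modsummable \<rho> v" "0 < c"
  shows "\<exists>n. \<bar>v n\<bar> \<le> c"
proof (rule ccontr)
  assume "\<not> ?thesis"
  then have "M (c / \<rho>) \<le> M (\<bar>v n\<bar> / \<rho>)" for n
    using assms by (intro M_mono divide_right_mono) (auto simp: not_le less_imp_le)
  then have "M (c / \<rho>) \<le> 0"
    using summable_LIMSEQ_zero[OF assms(2)[unfolded modsummable_def]]
    by (intro LIMSEQ_le_const) auto
  then show False using M_pos[of "c / \<rho>"] assms by auto
qed

section \<open>The maximal element and the contradiction\<close>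

text \<open>The functional \<open>L\<close> stands for the derivative: its boundedness gives
  continuity of \<open>b\<close> along chains, its oddness the freedom to choose the sign of a
  perturbation.\<close>

lemma no_positive_bump:
  assumes \<Delta>2: "Delta2_at_zero M" and p: "0 < p"
    and limsup: "Limsup (at_right 0) (\<lambda>t. ereal (M t / t powr p)) = \<infinity>"
    and supp: "\<And>x. x \<in> orlicz_space M \<Longrightarrow> b x \<noteq> 0 \<Longrightarrow> orlicz_norm M x \<le> R"
    and x0: "x0 \<in> orlicz_space M" "b x0 > 0"
    and expansion: "\<And>x. x \<in> orlicz_space M \<Longrightarrow> \<exists>L C K e. e > 0 \<and>
      (\<forall>h\<in>orlicz_space M. \<bar>L h\<bar> \<le> C * orlicz_norm M h \<and> L (\<lambda>n. - h n) = - L h \<and>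
        (orlicz_norm M h < e \<longrightarrow>
          \<bar>b (\<lambda>n. x n + h n) - b x - L h\<bar> \<le> K * orlicz_norm M h powr p))"
  shows False
proof -
  \<comment> \<open>Positive and strictly above \<open>R\<close>, so that the modular at scale
    \<open>\<rho>\<close> is at most 1 on the support of \<open>b\<close>.\<close>
  define \<rho> where "\<rho> = max R 0 + 1"
  have \<rho>: "\<rho> > 0" by (simp add: \<rho>_def)
  have S: "modsummable \<rho> x" "modsum \<rho> x \<le> 1" if "x \<in> orlicz_space M" "b x > 0" for x
    using modsum_le_1[of x \<rho>] supp[of x] that by (auto simp: \<rho>_def)
  \<comment> \<open>With the modular at most 1, the term added in \<open>g\<close> accounts for at
    most half of \<open>b x0\<close>; hence \<open>b\<close> stays positive at limits of
    chains.\<close>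
  define \<epsilon> where "\<epsilon> = b x0 / 2"
  have \<epsilon>: "\<epsilon> > 0" using x0 by (simp add: \<epsilon>_def)
  define g where "g x = b x + \<epsilon> * modsum \<rho> x" for x
  define le where "le v w \<longleftrightarrow> grows v w \<and> g v \<le> g w" for v w
  define A where "A = {x \<in> orlicz_space M. b x > 0 \<and> g x0 \<le> g x}"
  have "\<exists>v\<in>A. \<forall>w\<in>A. le v w \<longrightarrow> modsum \<rho> w \<le> modsum \<rho> v"
  proof (rule brezis_browder)
    show "x0 \<in> A" using x0 by (simp add: A_def)
    show "le x x" for x by (simp add: le_def grows_refl)
    show "le x z" if "le x y" "le y z" for x y z
      using that by (auto simp: le_def intro: grows_trans)
    show "modsum \<rho> x \<le> modsum \<rho> y" if "y \<in> A" "le x y" for x y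
      using that S \<rho> grows_modsum(2)[of \<rho> x y] by (auto simp: le_def A_def)
    show "modsum \<rho> x \<le> 1" if "x \<in> A" for x using S that by (auto simp: A_def)
    fix x :: "nat \<Rightarrow> nat \<Rightarrow> real"
    assume xA: "\<And>k. x k \<in> A" and inc: "\<And>k. le (x k) (x (Suc k))"
    have xS: "modsummable \<rho> (x k)" "modsum \<rho> (x k) \<le> 1" for k
      using S xA[of k] by (auto simp: A_def)
    obtain v where v: "modsummable \<rho> v" "modsum \<rho> v \<le> 1" "\<And>k. grows (x k) v"
      "(\<lambda>k. orlicz_norm M (\<lambda>n. x k n - v n)) \<longlonglongrightarrow> 0"
      using grows_chain_limit[OF \<Delta>2 \<rho>, of x 1] inc xS by (auto simp: le_def)
    have vX: "v \<in> orlicz_space M"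
      using modsummable_imp_mem v \<rho> by blast
    define h where "h k = (\<lambda>n. x k n - v n)" for k
    have hX: "h k \<in> orlicz_space M" for k
      using grows_modsum(3)[OF \<rho> v(3) v(1)] \<rho> modsummable_imp_mem[of "2 * \<rho>"] by (auto simp: h_def)
    have hlim: "(\<lambda>k. orlicz_norm M (h k)) \<longlonglongrightarrow> 0"
      using v(4) by (simp add: h_def)
    obtain L C K e where E: "e > 0" "\<And>h. h \<in> orlicz_space M \<Longrightarrow> \<bar>L h\<bar> \<le> C * orlicz_norm M h"
      "\<And>h. h \<in> orlicz_space M \<Longrightarrow> orlicz_norm M h < e \<Longrightarrow>
        \<bar>b (\<lambda>n. v n + h n) - b v - L h\<bar> \<le> K * orlicz_norm M h powr p"
      using expansion[OF vX] by blast
    have "\<forall>\<^sub>F k in sequentially. orlicz_norm M (h k) < e"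
      using hlim E(1) by (intro order_tendstoD)
    then have "\<forall>\<^sub>F k in sequentially. norm (b (x k) - b v) \<le>
        C * orlicz_norm M (h k) + K * orlicz_norm M (h k) powr p"
    proof eventually_elim
      case (elim k)
      have "(\<lambda>n. v n + h k n) = x k" by (simp add: h_def)
      then show ?case using E(2)[OF hX] E(3)[OF hX elim] by (smt (verit) real_norm_def)
    qed
    moreover have "(\<lambda>k. C * orlicz_norm M (h k) + K * orlicz_norm M (h k) powr p) \<longlonglongrightarrow> C * 0 + K * 0"
      using hlim p orlicz_norm_nonneg[OF hX]
      by (intro tendsto_intros tendsto_zero_powrI[of _ _ _ p]) auto
    then have "(\<lambda>k. C * orlicz_norm M (h k) + K * orlicz_norm M (h k) powr p) \<longlonglongrightarrow> 0"
      by simp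
    ultimately have "(\<lambda>k. b (x k) - b v) \<longlonglongrightarrow> 0"
      by (rule Lim_null_comparison)
    then have blim: "(\<lambda>k. b (x k)) \<longlonglongrightarrow> b v"
      using LIM_zero_iff by blast
    \<comment> \<open>Replacing the modular of \<open>x m\<close> by the larger one of
      \<open>v\<close> leaves only \<open>b\<close> to pass to the limit.\<close>
    have gle: "g (x k) \<le> g v" for k
    proof -
      have "g (x k) - \<epsilon> * modsum \<rho> v \<le> b (x m)" if "m \<ge> k" for m
      proof -
        have "g (x k) \<le> g (x m)"
          by (rule lift_Suc_mono_le[of "\<lambda>k. g (x k)", OF _ that]) (use inc in \<open>auto simp: le_def\<close>)
        moreover have "\<epsilon> * modsum \<rho> (x m) \<le> \<epsilon> * modsum \<rho> v"
          using grows_modsum(2)[OF \<rho> v(3) v(1)] \<epsilon> by (intro mult_left_mono) auto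
        ultimately show ?thesis by (simp add: g_def)
      qed
      then have "g (x k) - \<epsilon> * modsum \<rho> v \<le> b v"
        by (intro LIMSEQ_le_const[OF blim]) blast
      then show ?thesis by (simp add: g_def)
    qed
    have g0: "g x0 \<le> g v"
      using gle[of 0] xA[of 0] by (auto simp: A_def)
    \<comment> \<open>Here \<open>g v\<close> is at least \<open>2 * \<epsilon>\<close>, of which
      the modular contributes at most \<open>\<epsilon>\<close>.\<close>
    have "\<epsilon> * modsum \<rho> v \<le> \<epsilon> * 1" "0 \<le> \<epsilon> * modsum \<rho> x0"
      using v \<epsilon> modsum_nonneg[OF \<rho> S(1)[OF x0]] by (auto intro: mult_left_mono)
    moreover have "b x0 = 2 * \<epsilon>"
      by (simp add: \<epsilon>_def)
    ultimately have "b v > 0"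
      using g0 \<epsilon> unfolding g_def by linarith
    then show "\<exists>v\<in>A. \<forall>k. le (x k) v"
      using vX g0 gle v by (intro bexI[of _ v]) (auto simp: A_def le_def)
  qed
  then obtain v where v: "v \<in> A" and max: "\<And>w. w \<in> A \<Longrightarrow> le v w \<Longrightarrow> modsum \<rho> w \<le> modsum \<rho> v"
    by blast
  have vX: "v \<in> orlicz_space M" and bv: "b v > 0" using v by (auto simp: A_def)
  note vS = S(1)[OF vX bv]
  obtain L C K0 e where E: "e > 0"
    "\<And>h. h \<in> orlicz_space M \<Longrightarrow> L (\<lambda>n. - h n) = - L h"
    "\<And>h. h \<in> orlicz_space M \<Longrightarrow> orlicz_norm M h < e \<Longrightarrow>
      \<bar>b (\<lambda>n. v n + h n) - b v - L h\<bar> \<le> K0 * orlicz_norm M h powr p"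
    using expansion[OF vX] by blast
  define K where "K = \<bar>K0\<bar>"
  obtain \<kappa> where \<kappa>: "\<kappa> > 0" "\<And>n t. orlicz_norm M (\<lambda>k. if k = n then t else 0) \<le> \<kappa> * \<bar>t\<bar>"
    using norm_single_le by blast
  define c where "c = \<kappa> * (3 * \<rho> / 2)"
  have c: "c > 0" using \<kappa> \<rho> by (simp add: c_def)
  \<comment> \<open>Solved from the aim that the possible loss \<open>K * (c * u) powr p\<close> of
    \<open>b\<close> be below \<open>\<epsilon> * (M u / 2)\<close>, the guaranteed weighted gain of
    the modular.\<close>
  define G where "G = K * c powr p * (2 / \<epsilon>)"
  have "\<exists>\<^sub>F u in at_right 0. G < M u / u powr p"
  proof (rule ccontr)
    assume "\<not> ?thesis"
    then have "\<forall>\<^sub>F u in at_right 0. ereal (M u / u powr p) \<le> ereal G"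
      by (simp add: not_frequently not_less)
    then have "Limsup (at_right 0) (\<lambda>t. ereal (M t / t powr p)) \<le> ereal G"
      by (rule Limsup_bounded)
    then show False using limsup by simp
  qed
  \<comment> \<open>The infinite limsup makes \<open>M u / u powr p\<close> large only frequently;
    these conditions hold eventually and can be imposed at the same \<open>u\<close>. They put the
    perturbation in the range of the expansion and keep \<open>b\<close> positive.\<close>
  moreover have "\<forall>\<^sub>F u in at_right 0. c * u < e \<and> K * (c * u) powr p < b v \<and> 0 < u"
  proof (intro eventually_conj)
    have id: "((\<lambda>u. c * u) \<longlongrightarrow> 0) (at_right 0)"
      by (auto intro!: tendsto_eq_intros)
    show "\<forall>\<^sub>F u in at_right 0. c * u < e"
      using id E(1) by (rule order_tendstoD)
    show pos: "\<forall>\<^sub>F u in at_right (0::real). 0 < u"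
      by (simp add: eventually_at_right_less)
    have "((\<lambda>u. (c * u) powr p) \<longlongrightarrow> 0) (at_right 0)"
      by (rule tendsto_zero_powrI[OF id tendsto_const _ p])
        (use pos in eventually_elim, use c in auto)
    then have "((\<lambda>u. K * (c * u) powr p) \<longlongrightarrow> 0) (at_right 0)"
      by (rule tendsto_mult_right_zero)
    then show "\<forall>\<^sub>F u in at_right 0. K * (c * u) powr p < b v"
      using bv by (rule order_tendstoD)
  qed
  ultimately have "\<exists>\<^sub>F u in at_right 0. G < M u / u powr p \<and>
      (c * u < e \<and> K * (c * u) powr p < b v \<and> 0 < u)"
    by (rule frequently_rev_mp[OF _ eventually_mono]) blast
  then obtain u where u: "G < M u / u powr p" "c * u < e" "K * (c * u) powr p < b v" "0 < u"
    using frequently_ex by blast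
  have Mu: "K * (c * u) powr p \<le> \<epsilon> * (M u / 2)"
    using u c \<epsilon> by (simp add: G_def powr_mult field_simps)
  \<comment> \<open>A coordinate of size at most \<open>t / 3\<close>, moved by \<open>t\<close>
    either way, ends at size at least \<open>2 * t / 3\<close>, so it at least doubles. The factor
    makes \<open>2 * t / 3\<close> equal to \<open>\<rho> * u\<close>, so the new term of the
    modular is at least \<open>M u\<close>.\<close>
  define t where "t = 3 * \<rho> / 2 * u"
  have t: "t > 0" "\<kappa> * t = c * u" "2 * t / 3 = \<rho> * u"
    using u \<rho> by (auto simp: t_def c_def)
  obtain n where n: "\<bar>v n\<bar> \<le> t / 3"
    using exists_small_coordinate[OF \<rho> vS, of "t / 3"] t by auto
  define H where "H s = (\<lambda>k. if k = n then s else 0)" for s :: real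
  have HX: "H s \<in> orlicz_space M" for s
    using modsum_single[OF \<rho>] \<rho> modsummable_imp_mem by (auto simp: H_def)
  have "L (H (- t)) = - L (H t)"
    using E(2)[OF HX[of t]] by (simp add: H_def if_distrib cong: if_cong)
  then obtain s where s: "\<bar>s\<bar> = t" "L (H s) \<ge> 0"
    using t by (cases "L (H t) \<ge> 0") (auto intro: that[of t] that[of "- t"])
  have Hn: "0 \<le> orlicz_norm M (H s)" "orlicz_norm M (H s) \<le> c * u"
    using orlicz_norm_nonneg[OF HX] \<kappa>(2)[of n s] s t by (auto simp: H_def)
  define w where "w = (\<lambda>k. v k + H s k)"
  have "\<bar>b w - b v - L (H s)\<bar> \<le> K0 * orlicz_norm M (H s) powr p"
    unfolding w_def using Hn u by (intro E(3) HX) auto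
  also have "\<dots> \<le> K * (c * u) powr p"
    using Hn p by (intro mult_mono powr_mono2) (auto simp: K_def)
  finally have bw: "b v - K * (c * u) powr p \<le> b w"
    using s by linarith
  have wS: "modsummable \<rho> w" "modsum \<rho> w = modsum \<rho> v + (M (\<bar>w n\<bar> / \<rho>) - M (\<bar>v n\<bar> / \<rho>))"
    using modsum_add_single[OF \<rho> vS, of n s] by (simp_all add: w_def H_def)
  have "w n = v n + s"
    by (simp add: w_def H_def)
  then have wn: "\<bar>w n\<bar> \<ge> 2 * t / 3" "\<bar>w n\<bar> \<ge> 2 * \<bar>v n\<bar>"
    using n s by linarith+
  \<comment> \<open>By doubling and convexity the old term is at most half of the new one, so the
    gain is at least the other half.\<close>
  have "M (\<bar>v n\<bar> / \<rho>) \<le> M (\<bar>w n\<bar> / \<rho> / 2)"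
    using wn \<rho> by (intro M_mono) (auto simp: field_simps)
  also have "\<dots> \<le> M (\<bar>w n\<bar> / \<rho>) / 2"
    using \<rho> by (intro M_half) auto
  finally have gain1: "M (\<bar>w n\<bar> / \<rho>) / 2 \<le> M (\<bar>w n\<bar> / \<rho>) - M (\<bar>v n\<bar> / \<rho>)"
    by simp
  have "M u \<le> M (\<bar>w n\<bar> / \<rho>)"
    using wn t u \<rho> by (intro M_mono) (auto simp: field_simps)
  then have gain: "modsum \<rho> v + M u / 2 \<le> modsum \<rho> w"
    using gain1 wS by linarith
  then have "\<epsilon> * (modsum \<rho> v + M u / 2) \<le> \<epsilon> * modsum \<rho> w"
    using \<epsilon> by (intro mult_left_mono) auto
  then have "g v \<le> g w"
    using bw Mu by (simp add: g_def algebra_simps)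
  moreover have "grows v w"
    unfolding grows_def using wn by (auto simp: w_def H_def)
  moreover have "w \<in> A"
    using modsummable_imp_mem[OF \<rho> wS(1)] bw u v \<open>g v \<le> g w\<close> by (auto simp: A_def)
  ultimately have "modsum \<rho> w \<le> modsum \<rho> v"
    by (intro max) (auto simp: le_def)
  then show False using gain M_pos[OF u(4)] by linarith
qed

end

section \<open>From Landau notation to explicit estimates\<close>

lemma eventually_orlicz_nhds_zero:
  "eventually P (orlicz_nhds_zero M) \<longleftrightarrow>
     (\<exists>e>0. \<forall>h\<in>orlicz_space M. \<bar>orlicz_norm M h\<bar> < e \<longrightarrow> P h)"
proof -
  have "eventually P (orlicz_nhds_zero M) \<longleftrightarrow>
      (\<exists>Q. eventually Q (nhds 0) \<and> (\<forall>h. Q (orlicz_norm M h) \<longrightarrow> h \<in> orlicz_space M \<longrightarrow> P h))"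
    by (simp add: orlicz_nhds_zero_def eventually_inf_principal eventually_filtercomap)
  also have "\<dots> \<longleftrightarrow> (\<exists>e>0. \<forall>h\<in>orlicz_space M. \<bar>orlicz_norm M h\<bar> < e \<longrightarrow> P h)"
    unfolding eventually_nhds_metric dist_real_def
  proof safe
    fix e :: real
    assume "e > 0" "\<forall>h\<in>orlicz_space M. \<bar>orlicz_norm M h\<bar> < e \<longrightarrow> P h"
    then show "\<exists>Q. (\<exists>d>0. \<forall>x. \<bar>x - 0\<bar> < d \<longrightarrow> Q x) \<and>
        (\<forall>h. Q (orlicz_norm M h) \<longrightarrow> h \<in> orlicz_space M \<longrightarrow> P h)"
      by (intro exI[of _ "\<lambda>r. \<bar>r\<bar> < e"]) auto
  qed fastforce
  finally show ?thesis .
qed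

theorem proposition5p2:
  fixes M :: "real \<Rightarrow> real" and p :: real
  assumes "orlicz_function M" and "\<not> degenerate M" and "Delta2_at_zero M"
    and "1 < p" and "p \<le> 2"
    and "Limsup (at_right 0) (\<lambda>t. ereal (M t / t powr p)) = \<infinity>"
  shows "\<not> (\<exists>(b :: (nat \<Rightarrow> real) \<Rightarrow> real) (b' :: (nat \<Rightarrow> real) \<Rightarrow> (nat \<Rightarrow> real) \<Rightarrow> real).
    bump M b \<and> nontrivial M b \<and>
    (\<forall>x\<in>orlicz_space M. has_frechet_derivative M b (b' x) x) \<and>
    (\<forall>x\<in>orlicz_space M.
       (\<lambda>h. b (\<lambda>n. x n + h n) - b x - b' x h) \<in> O[orlicz_nhds_zero M](\<lambda>h. orlicz_norm M h powr p)))"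
proof safe
  fix b :: "(nat \<Rightarrow> real) \<Rightarrow> real" and b' :: "(nat \<Rightarrow> real) \<Rightarrow> (nat \<Rightarrow> real) \<Rightarrow> real"
  assume "bump M b" "nontrivial M b"
    and diff: "\<forall>x\<in>orlicz_space M. has_frechet_derivative M b (b' x) x"
    and bigo: "\<forall>x\<in>orlicz_space M. (\<lambda>h. b (\<lambda>n. x n + h n) - b x - b' x h)
      \<in> O[orlicz_nhds_zero M](\<lambda>h. orlicz_norm M h powr p)"
  interpret orlicz M
    using assms by unfold_locales
  obtain R where R: "\<And>x. x \<in> orlicz_space M \<Longrightarrow> b x \<noteq> 0 \<Longrightarrow> orlicz_norm M x \<le> R"
    using \<open>bump M b\<close> by (auto simp: bump_def)
  obtain x0 where x0: "x0 \<in> orlicz_space M" "b x0 \<noteq> 0"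
    using \<open>nontrivial M b\<close> by (auto simp: nontrivial_def)
  \<comment> \<open>The sign \<open>\<sigma>\<close> allows replacing \<open>b\<close> by its
    negative, so that it becomes positive at \<open>x0\<close>.\<close>
  have expansion: "\<exists>L C K e. e > 0 \<and>
      (\<forall>h\<in>orlicz_space M. \<bar>L h\<bar> \<le> C * orlicz_norm M h \<and> L (\<lambda>n. - h n) = - L h \<and>
        (orlicz_norm M h < e \<longrightarrow>
          \<bar>\<sigma> * b (\<lambda>n. x n + h n) - \<sigma> * b x - L h\<bar> \<le> K * orlicz_norm M h powr p))"
    if x: "x \<in> orlicz_space M" and \<sigma>: "\<bar>\<sigma>\<bar> = 1" for x and \<sigma> :: real
  proof -
    have "b' x \<in> orlicz_dual M"
      using diff x by (auto simp: has_frechet_derivative_def)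
    then have hom: "\<And>h c. h \<in> orlicz_space M \<Longrightarrow> b' x (\<lambda>n. c * h n) = c * b' x h"
      and "\<exists>C. \<forall>h\<in>orlicz_space M. \<bar>b' x h\<bar> \<le> C * orlicz_norm M h"
      by (auto simp: orlicz_dual_def)
    then obtain C where C: "\<And>h. h \<in> orlicz_space M \<Longrightarrow> \<bar>b' x h\<bar> \<le> C * orlicz_norm M h"
      by blast
    obtain K where "\<forall>\<^sub>F h in orlicz_nhds_zero M.
        norm (b (\<lambda>n. x n + h n) - b x - b' x h) \<le> K * norm (orlicz_norm M h powr p)"
      using bspec[OF bigo x] by (auto elim!: landau_o.bigE)
    then obtain e where e: "e > 0" "\<And>h. h \<in> orlicz_space M \<Longrightarrow> \<bar>orlicz_norm M h\<bar> < e \<Longrightarrow>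
        \<bar>b (\<lambda>n. x n + h n) - b x - b' x h\<bar> \<le> K * orlicz_norm M h powr p"
      by (auto simp: eventually_orlicz_nhds_zero)
    have "\<bar>\<sigma> * b (\<lambda>n. x n + h n) - \<sigma> * b x - \<sigma> * b' x h\<bar> = \<bar>b (\<lambda>n. x n + h n) - b x - b' x h\<bar>" for h
      using \<sigma> by (simp add: abs_mult flip: right_diff_distrib)
    \<comment> \<open>Oddness of the functional is homogeneity of the derivative with factor
      -1.\<close>
    then show ?thesis
      using C hom[of _ "-1"] e \<sigma> orlicz_norm_nonneg
      by (intro exI[of _ "\<lambda>h. \<sigma> * b' x h"] exI[of _ C] exI[of _ K] exI[of _ e])
        (auto simp: abs_mult)
  qed
  show False
  proof (rule no_positive_bump[of p "\<lambda>x. sgn (b x0) * b x" R x0])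
    show "0 < sgn (b x0) * b x0"
      using x0 by (simp add: sgn_if)
    show "orlicz_norm M x \<le> R" if "x \<in> orlicz_space M" "sgn (b x0) * b x \<noteq> 0" for x
      using R that by auto
  qed (use assms x0 expansion[of _ "sgn (b x0)"] in \<open>auto simp: abs_sgn_eq\<close>)
qed

end
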